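(* For any representation $V(\mu_X,1,\mathcal C)$ on $L^2(X,\mu_X)$, where $\mu_X$ is the Haar measure of $X=\mathbb Z_2^\infty$, the domains of $D$ and $D'$ contain the algebraic span of the Walsh basis and of the Fourier basis and, therefore, are dense in $L^2(X)$.
   Context: $X=\mathbb Z_2^{\infty}$ is the compact abelian group of sequences $x=(x_1,x_2,\dots)$ of $0$'s and $1$'s with componentwise addition mod $2$, with Haar measure $\mu_X$. $\delta^k\in X$ has a $1$ in position $k$ and $0$ elsewhere; $\Delta\subset X$ is the subgroup of sequences with finitely many $1$'s. A representation $V(\mu_X,1,\mathcal C)$ is given by measurable functions $c_k:X\to\{z\in\mathbb C:|z|=1\}$, $k\ge1$, with $\overline{c_k(x)}=c_k(x+\delta^k)$ and $c_k(x)c_l(x+\delta^k)=c_l(x)c_k(x+\delta^l)$ for all $k,l$ and almost all $x$; it is $L^2(X)=L^2(X,\mu_X;\mathbb C)$ with the operators $$J_kf(x)=-i(-1)^{x_1+\dots+x_{k-1}}c_k(x)f(x+\delta^k),\qquad J_k'f(x)=(-1)^{x_1+\dots+x_{k}}c_k(x)f(x+\delta^k).$$ Set $a_k=\frac12(iJ_k-J_k')$, with adjoint $a_k^*=\frac12(iJ_k+J_k')$, and $\partial_kf(x)=(-1)^{x_k}(f(x+\delta^k)-f(x))$. Then $D=\sum_{k\ge1}a_k\partial_k$ and $D'=\sum_{k\ge1}a_k^*\partial_k$, with domain the set of $f\in L^2(X)$ for which the series converges in $L^2(X)$. The Walsh basis is $\{\phi_\alpha:\alpha\in\Delta\}$,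 $\phi_\alpha(x)=(-1)^{\sum_k\alpha_kx_k}$. The Fourier basis is $\{e^{2\pi int}:n\in\mathbb Z\}$, where $X$ is identified, up to null sets, with $(0,1)\approx\mathbb T$ via the dyadic expansion $t=\sum_{k\ge1}x_k2^{-k}$ (Haar measure corresponding to Lebesgue measure). *)

theory Defs
  imports "HOL-Probability.Probability" "HOL-Library.Z2" "HOL-Library.Function_Algebras"
begin

text \<open>
  The group \<open>X\<close> of 0-1 sequences is the type \<open>nat \<Rightarrow> bit\<close> with the pointwise addition of
  \<open>Function_Algebras\<close>.  Positions are numbered from 0: the value \<open>x k\<close> is the coordinate
  that is usually written with index \<open>k + 1\<close>, and likewise \<open>\<delta> k\<close>, \<open>c k\<close>, \<open>J c k\<close> etc.
  carry the usual index \<open>k + 1\<close>.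
\<close>

type_synonym seq2 = "nat \<Rightarrow> bit"

definition \<delta> :: "nat \<Rightarrow> seq2"
  where "\<delta> k = (\<lambda>j. of_bool (j = k))"

definition \<Delta> :: "seq2 set"
  where "\<Delta> = {x. finite {k. x k \<noteq> 0}}"

text \<open>
  Normalised Haar measure.  Since \<open>bit\<close> is finite and the index set is countable, the product
  of the discrete sigma-algebras is the Borel sigma-algebra of the product topology.
\<close>

definition haar_measure :: "seq2 measure \<Rightarrow> bool"
  where "haar_measure \<mu> \<longleftrightarrow>
    sets \<mu> = sets (\<Pi>\<^sub>M k\<in>(UNIV :: nat set). count_space (UNIV :: bit set)) \<and>
    prob_space \<mu> \<and>
    (\<forall>g. distr \<mu> \<mu> (\<lambda>x. g + x) = \<mu>)"

text \<open>
  Elements of \<open>L\<^sup>2(X, \<mu>)\<close> are represented by functions; two functions that agree almost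
  everywhere represent the same element, and every notion below respects this.
\<close>

definition L2 :: "seq2 measure \<Rightarrow> (seq2 \<Rightarrow> complex) set"
  where "L2 \<mu> = {f. f \<in> borel_measurable \<mu> \<and> integrable \<mu> (\<lambda>x. (cmod (f x))\<^sup>2)}"

definition L2_norm :: "seq2 measure \<Rightarrow> (seq2 \<Rightarrow> complex) \<Rightarrow> real"
  where "L2_norm \<mu> f = sqrt (\<integral>x. (cmod (f x))\<^sup>2 \<partial>\<mu>)"

definition L2_tendsto :: "seq2 measure \<Rightarrow> (nat \<Rightarrow> seq2 \<Rightarrow> complex) \<Rightarrow> (seq2 \<Rightarrow> complex) \<Rightarrow> bool"
  where "L2_tendsto \<mu> S g \<longleftrightarrow>
    (\<forall>n. S n \<in> L2 \<mu>) \<and> g \<in> L2 \<mu> \<and> (\<lambda>n. L2_norm \<mu> (\<lambda>x. S n x - g x)) \<longlonglongrightarrow> 0"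

definition L2_dense :: "seq2 measure \<Rightarrow> (seq2 \<Rightarrow> complex) set \<Rightarrow> bool"
  where "L2_dense \<mu> A \<longleftrightarrow>
    A \<subseteq> L2 \<mu> \<and> (\<forall>g\<in>L2 \<mu>. \<forall>\<epsilon>>0. \<exists>f\<in>A. L2_norm \<mu> (\<lambda>x. f x - g x) < \<epsilon>)"

text \<open>The data \<open>\<C>\<close> of a representation \<open>V(\<mu>, 1, \<C>)\<close>.\<close>

definition clifford_rep :: "seq2 measure \<Rightarrow> (nat \<Rightarrow> seq2 \<Rightarrow> complex) \<Rightarrow> bool"
  where "clifford_rep \<mu> c \<longleftrightarrow>
    (\<forall>k. c k \<in> borel_measurable \<mu>) \<and>
    (\<forall>k x. cmod (c k x) = 1) \<and>
    (\<forall>k. AE x in \<mu>. cnj (c k x) = c k (x + \<delta> k)) \<and>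
    (\<forall>k l. AE x in \<mu>. c k x * c l (x + \<delta> k) = c l x * c k (x + \<delta> l))"

definition J :: "(nat \<Rightarrow> seq2 \<Rightarrow> complex) \<Rightarrow> nat \<Rightarrow> (seq2 \<Rightarrow> complex) \<Rightarrow> seq2 \<Rightarrow> complex"
  where "J c k f = (\<lambda>x. - \<i> * (-1) ^ (\<Sum>j<k. of_bit (x j) :: nat) * c k x * f (x + \<delta> k))"

definition J' :: "(nat \<Rightarrow> seq2 \<Rightarrow> complex) \<Rightarrow> nat \<Rightarrow> (seq2 \<Rightarrow> complex) \<Rightarrow> seq2 \<Rightarrow> complex"
  where "J' c k f = (\<lambda>x. (-1) ^ (\<Sum>j\<le>k. of_bit (x j) :: nat) * c k x * f (x + \<delta> k))"

definition ann :: "(nat \<Rightarrow> seq2 \<Rightarrow> complex) \<Rightarrow> nat \<Rightarrow> (seq2 \<Rightarrow> complex) \<Rightarrow> seq2 \<Rightarrow> complex"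
  where "ann c k f = (\<lambda>x. 1 / 2 * (\<i> * J c k f x - J' c k f x))"

text \<open>
  The adjoint of \<^term>\<open>ann c k\<close>: the operators \<^term>\<open>J c k\<close> and \<^term>\<open>J' c k\<close> are skew-adjoint.
\<close>

definition ann_adj :: "(nat \<Rightarrow> seq2 \<Rightarrow> complex) \<Rightarrow> nat \<Rightarrow> (seq2 \<Rightarrow> complex) \<Rightarrow> seq2 \<Rightarrow> complex"
  where "ann_adj c k f = (\<lambda>x. 1 / 2 * (\<i> * J c k f x + J' c k f x))"

definition pd :: "nat \<Rightarrow> (seq2 \<Rightarrow> complex) \<Rightarrow> seq2 \<Rightarrow> complex"
  where "pd k f = (\<lambda>x. (-1) ^ (of_bit (x k) :: nat) * (f (x + \<delta> k) - f x))"

definition dom_D :: "seq2 measure \<Rightarrow> (nat \<Rightarrow> seq2 \<Rightarrow> complex) \<Rightarrow> (seq2 \<Rightarrow> complex) set"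
  where "dom_D \<mu> c =
    {f \<in> L2 \<mu>. \<exists>g. L2_tendsto \<mu> (\<lambda>n x. \<Sum>k<n. ann c k (pd k f) x) g}"

definition dom_D' :: "seq2 measure \<Rightarrow> (nat \<Rightarrow> seq2 \<Rightarrow> complex) \<Rightarrow> (seq2 \<Rightarrow> complex) set"
  where "dom_D' \<mu> c =
    {f \<in> L2 \<mu>. \<exists>g. L2_tendsto \<mu> (\<lambda>n x. \<Sum>k<n. ann_adj c k (pd k f) x) g}"

definition walsh :: "seq2 \<Rightarrow> seq2 \<Rightarrow> complex"
  where "walsh \<alpha> x = (-1) ^ (\<Sum>k | \<alpha> k \<noteq> 0. of_bit (\<alpha> k * x k) :: nat)"

definition walsh_basis :: "(seq2 \<Rightarrow> complex) set"
  where "walsh_basis = walsh ` \<Delta>"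

definition dyadic :: "seq2 \<Rightarrow> real"
  where "dyadic x = (\<Sum>k. of_bit (x k) / 2 ^ Suc k)"

definition fourier :: "int \<Rightarrow> seq2 \<Rightarrow> complex"
  where "fourier n x = exp (2 * of_real pi * \<i> * of_int n * of_real (dyadic x))"

definition fourier_basis :: "(seq2 \<Rightarrow> complex) set"
  where "fourier_basis = range fourier"

global_interpretation fun_complex: vector_space "\<lambda>(a::complex) (f :: seq2 \<Rightarrow> complex) x. a * f x"
  by unfold_locales (auto simp: fun_eq_iff algebra_simps)

lemma haar_measure_product:
  "haar_measure (\<Pi>\<^sub>M k\<in>(UNIV :: nat set). uniform_count_measure (UNIV :: bit set))"
proof -
  have UNIV_bit: "(UNIV :: bit set) = {0, 1}"
    by (metis (full_types) UNIV_eq_I bit.exhaust insert_iff)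
  define U where "U = uniform_count_measure (UNIV :: bit set)"
  have fin: "finite (UNIV :: bit set)"
    by (simp add: UNIV_bit)
  interpret U: prob_space U
    unfolding U_def by (rule prob_space_uniform_count_measure[OF fin]) simp
  interpret P: product_prob_space "\<lambda>_::nat. U" UNIV
    by unfold_locales
  have sets_U: "sets U = sets (count_space UNIV)"
    by (simp add: U_def sets_uniform_count_measure)
  have sets_P: "sets (\<Pi>\<^sub>M k\<in>(UNIV :: nat set). U) = sets (\<Pi>\<^sub>M k\<in>(UNIV :: nat set). count_space (UNIV :: bit set))"
    by (rule sets_PiM_cong) (simp_all add: sets_U)
  let ?P = "\<Pi>\<^sub>M k\<in>(UNIV :: nat set). U"
  have space_U: "space U = UNIV"
    by (simp add: U_def space_uniform_count_measure)
  have space_P: "space ?P = UNIV"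
    by (simp add: space_PiM space_U)
  have inv: "distr ?P ?P (\<lambda>x. g + x) = ?P" for g
  proof -
    have meas: "(\<lambda>x. g + x) \<in> ?P \<rightarrow>\<^sub>M ?P"
    proof (rule measurable_PiM_single')
      show "(\<lambda>x. (g + x) i) \<in> ?P \<rightarrow>\<^sub>M U" for i
      proof -
        have "(\<lambda>b. g i + b) \<in> U \<rightarrow>\<^sub>M U"
          by (simp add: measurable_cong_sets[OF sets_U sets_U])
        then show ?thesis
          unfolding plus_fun_def by measurable
      qed
    qed (simp add: space_P space_U)
    show ?thesis
    proof (rule measure_eqI_PiM_infinite[symmetric, OF refl])
      show "sets (distr ?P ?P (\<lambda>x. g + x)) = sets ?P" by simp
      show "finite_measure ?P" by unfold_locales
      fix I :: "nat set" and F :: "nat \<Rightarrow> bit set"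
      assume I: "finite I" and F: "\<And>j. j \<in> I \<Longrightarrow> F j \<in> sets U"
      let ?F = "\<lambda>j. (\<lambda>b. g j + b) ` F j"
      have self: "g j + (g j + b) = b" for j b
        by (cases "g j"; cases b) auto
      have vimage: "(\<lambda>x. g + x) -` prod_emb UNIV (\<lambda>_. U) I (Pi\<^sub>E I F) \<inter> space ?P
          = prod_emb UNIV (\<lambda>_. U) I (Pi\<^sub>E I ?F)"
      proof -
        have "g j + b \<in> F j \<longleftrightarrow> b \<in> ?F j" for j b
          using self by (metis (no_types, lifting) image_iff)
        then show ?thesis
          by (auto simp: prod_emb_def space_P space_U PiE_def Pi_def simp del: add_bit_eq_xor)
      qed
      have "emeasure (distr ?P ?P (\<lambda>x. g + x)) (prod_emb UNIV (\<lambda>_. U) I (Pi\<^sub>E I F))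
          = emeasure ?P ((\<lambda>x. g + x) -` prod_emb UNIV (\<lambda>_. U) I (Pi\<^sub>E I F) \<inter> space ?P)"
        using F I by (intro emeasure_distr meas sets_PiM_I) auto
      also have "\<dots> = (\<Prod>j\<in>I. emeasure U (?F j))"
        unfolding vimage using I by (intro P.emeasure_PiM_emb) (auto simp: sets_U)
      also have "\<dots> = (\<Prod>j\<in>I. emeasure U (F j))"
      proof (rule prod.cong)
        fix j
        have "card (?F j) = card (F j)"
          by (rule card_image) (metis (no_types, lifting) inj_onI self)
        then show "emeasure U (?F j) = emeasure U (F j)"
          using fin by (simp add: U_def emeasure_uniform_count_measure)
      qed simp
      also have "\<dots> = emeasure ?P (prod_emb UNIV (\<lambda>_. U) I (Pi\<^sub>E I F))"
        using I F by (intro P.emeasure_PiM_emb[symmetric]) auto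
      finally show "emeasure ?P (prod_emb UNIV (\<lambda>_. U) I (Pi\<^sub>E I F))
          = emeasure (distr ?P ?P (\<lambda>x. g + x)) (prod_emb UNIV (\<lambda>_. U) I (Pi\<^sub>E I F))"
        by (rule sym)
    qed
  qed
  show ?thesis
    using inv sets_P P.prob_space_axioms unfolding haar_measure_def U_def by simp
qed

end

theory Submission
  imports Defs
begin

text \<open>
  Since \<open>|c\<^sub>k| = 1\<close>, we have \<open>|a\<^sub>k \<partial>\<^sub>k f (x)| \<le> |f (x) - f (x + \<delta>\<^sup>k)|\<close>, and likewise for
  the adjoints.  So both series converge uniformly, hence in \<open>L\<^sup>2\<close>, for every bounded measurable \<open>f\<close>
  whose increments satisfy \<open>|f (x + \<delta>\<^sup>k) - f (x)| \<le> C 2\<^sup>-\<^sup>k\<close>.  Such functions form a linear space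
  that contains the functions of finitely many coordinates, among them the Walsh functions, and
  also the Fourier functions, because flipping the \<open>k\<close>th binary digit moves \<open>t\<close> by \<open>2\<^sup>-\<^sup>k\<close>.
  Density holds since its \<open>L\<^sup>2\<close> closure contains the indicators of cylinder sets, so of all measurable
  sets by a \<open>\<pi>\<close>-\<open>\<lambda>\<close> argument, and then all of \<open>L\<^sup>2\<close> by dominated convergence.
\<close>

section \<open>Functions with geometrically decaying increments\<close>

text \<open>If flipping digit \<open>k\<close> is regarded as a move of length
  \<open>2 ^ -k\<close>, the last condition is a Lipschitz bound for single flips. Positions start
  at 0; the resulting factor 2 is absorbed in \<open>C\<close>. Both bounds hold at every point, so
  later estimates involve no null sets.\<close>

definition lipschitz2 :: "seq2 measure \<Rightarrow> (seq2 \<Rightarrow> complex) set"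
  where "lipschitz2 \<mu> = {f \<in> borel_measurable \<mu>.
    (\<exists>B. \<forall>x. cmod (f x) \<le> B) \<and> (\<exists>C. \<forall>k x. cmod (f (x + \<delta> k) - f x) \<le> C / 2 ^ k)}"

lemma lipschitz2I:
  assumes "f \<in> borel_measurable \<mu>" "\<And>x. cmod (f x) \<le> B"
    and "\<And>k x. cmod (f (x + \<delta> k) - f x) \<le> C / 2 ^ k"
  shows "f \<in> lipschitz2 \<mu>"
  using assms unfolding lipschitz2_def by blast

lemma lipschitz2E:
  assumes "f \<in> lipschitz2 \<mu>"
  obtains B C where "f \<in> borel_measurable \<mu>" "\<And>x. cmod (f x) \<le> B"
    and "\<And>k x. cmod (f (x + \<delta> k) - f x) \<le> C / 2 ^ k"
  using assms unfolding lipschitz2_def by blast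

lemma subspace_lipschitz2: "fun_complex.subspace (lipschitz2 \<mu>)"
proof (rule fun_complex.subspaceI)
  show "0 \<in> lipschitz2 \<mu>"
    by (rule lipschitz2I[where B = 0 and C = 0]) (auto simp: zero_fun_def)
next
  fix f g assume f: "f \<in> lipschitz2 \<mu>" and g: "g \<in> lipschitz2 \<mu>"
  obtain B C where 1: "f \<in> borel_measurable \<mu>" "\<And>x. cmod (f x) \<le> B"
    "\<And>k x. cmod (f (x + \<delta> k) - f x) \<le> C / 2 ^ k" using f by (rule lipschitz2E) blast
  obtain B' C' where 2: "g \<in> borel_measurable \<mu>" "\<And>x. cmod (g x) \<le> B'"
    "\<And>k x. cmod (g (x + \<delta> k) - g x) \<le> C' / 2 ^ k" using g by (rule lipschitz2E) blast
  show "f + g \<in> lipschitz2 \<mu>"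
  proof (rule lipschitz2I)
    show "f + g \<in> borel_measurable \<mu>" using 1(1) 2(1) by (simp add: plus_fun_def)
    show "cmod ((f + g) x) \<le> B + B'" for x
      using norm_triangle_mono[OF 1(2) 2(2)] by simp
    show "cmod ((f + g) (x + \<delta> k) - (f + g) x) \<le> (C + C') / 2 ^ k" for k x
      using norm_triangle_mono[OF 1(3)[of x k] 2(3)[of x k]]
      by (simp add: algebra_simps add_divide_distrib)
  qed
next
  fix a :: complex and f assume f: "f \<in> lipschitz2 \<mu>"
  obtain B C where 1: "f \<in> borel_measurable \<mu>" "\<And>x. cmod (f x) \<le> B"
    "\<And>k x. cmod (f (x + \<delta> k) - f x) \<le> C / 2 ^ k" using f by (rule lipschitz2E) blast
  show "(\<lambda>x. a * f x) \<in> lipschitz2 \<mu>"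
  proof (rule lipschitz2I)
    show "(\<lambda>x. a * f x) \<in> borel_measurable \<mu>" using 1(1) by simp
    show "cmod (a * f x) \<le> cmod a * B" for x
      by (simp add: norm_mult 1(2) mult_left_mono)
    show "cmod (a * f (x + \<delta> k) - a * f x) \<le> (cmod a * C) / 2 ^ k" for k x
      using mult_left_mono[OF 1(3)[of x k], of "cmod a"]
      by (simp flip: norm_mult right_diff_distrib)
  qed
qed

text \<open>Only flips at the finitely many positions in \<open>I\<close> change \<open>f\<close>,
  so decay in \<open>k\<close> is just a matter of a large constant. This serves the Walsh functions
  and the indicators of cylinder sets.\<close>

lemma lipschitz2_finite_support:
  assumes "f \<in> borel_measurable \<mu>" "\<And>x. cmod (f x) \<le> B" "finite I"
    and "\<And>k x. k \<notin> I \<Longrightarrow> f (x + \<delta> k) = f x"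
  shows "f \<in> lipschitz2 \<mu>"
proof (rule lipschitz2I[OF assms(1,2)])
  fix k x
  have B: "B \<ge> 0" using assms(2)[of 0] norm_ge_zero order_trans by blast
  \<comment> \<open>Every increment is at most \<open>2 * B\<close>, and the sum over
    \<open>I\<close> dominates each single \<open>2 ^ k\<close> with \<open>k\<close> in
    \<open>I\<close>. Off \<open>I\<close> the increment is 0.\<close>
  show "cmod (f (x + \<delta> k) - f x) \<le> (2 * B * (\<Sum>j\<in>I. 2 ^ j)) / 2 ^ k"
  proof (cases "k \<in> I")
    case True
    have "(2::real) ^ k \<le> (\<Sum>j\<in>I. 2 ^ j)"
      using assms(3) True by (intro member_le_sum) auto
    then have "2 * B * 2 ^ k \<le> 2 * B * (\<Sum>j\<in>I. 2 ^ j)"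
      using B by (intro mult_left_mono) auto
    moreover have "cmod (f (x + \<delta> k) - f x) \<le> 2 * B"
      using norm_triangle_ineq4[of "f (x + \<delta> k)" "f x"] assms(2)[of "x + \<delta> k"] assms(2)[of x]
      by linarith
    ultimately have "cmod (f (x + \<delta> k) - f x) * 2 ^ k \<le> 2 * B * (\<Sum>j\<in>I. 2 ^ j)"
      by (meson mult_right_mono order_trans zero_le_numeral zero_le_power)
    then show ?thesis by (simp add: pos_le_divide_eq)
  next
    case False
    then show ?thesis using B assms(4) by (simp add: sum_nonneg)
  qed
qed

lemma add_delta_apply: "(x + \<delta> k) j = (if j = k then x j + 1 else x j)"
  by (simp add: \<delta>_def)

section \<open>Elementary estimates\<close>

text \<open>A chord of the unit circle is no longer than its arc: the chord has length 2 |sin((s -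
  t)/2)|.\<close>

lemma norm_exp_i_diff_le: "cmod (exp (\<i> * of_real s) - exp (\<i> * of_real t)) \<le> \<bar>s - t\<bar>"
proof -
  have "exp (\<i> * of_real s) - exp (\<i> * of_real t)
      = exp (\<i> * of_real t) * (exp (\<i> * of_real (s - t)) - 1)"
    by (simp add: algebra_simps flip: exp_add)
  then have "cmod (exp (\<i> * of_real s) - exp (\<i> * of_real t)) = 2 * \<bar>sin ((s - t) / 2)\<bar>"
    by (simp only: norm_mult norm_exp_i_times dist_exp_i_1 mult_1)
  also have "\<dots> \<le> \<bar>s - t\<bar>"
    using abs_sin_x_le_abs_x[of "(s - t) / 2"] by simp
  finally show ?thesis .
qed

text \<open>All terms but the one at \<open>k\<close> cancel, and that digit has weight
  \<open>1 / 2 ^ Suc k\<close>. Carries and ambiguous expansions do not arise, since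
  \<open>dyadic\<close> is a function of the digit sequence.\<close>

lemma dyadic_add_delta: "\<bar>dyadic (x + \<delta> k) - dyadic x\<bar> = 1 / 2 ^ Suc k"
proof -
  have s: "summable (\<lambda>j. of_bit (y j) / 2 ^ Suc j :: real)" for y :: seq2
  proof (rule summable_comparison_test')
    show "summable (\<lambda>j. (1 / 2) ^ j :: real)" by (simp add: summable_geometric)
    show "norm (of_bit (y j) / 2 ^ Suc j :: real) \<le> (1 / 2) ^ j" for j
      by (cases "y j") (auto simp: power_divide divide_simps)
  qed
  have "dyadic (x + \<delta> k) - dyadic x
      = (\<Sum>j. of_bit ((x + \<delta> k) j) / 2 ^ Suc j - of_bit (x j) / 2 ^ Suc j)"
    unfolding dyadic_def by (rule suminf_diff[OF s s])
  also have "\<dots> = (\<Sum>j\<in>{k}. of_bit ((x + \<delta> k) j) / 2 ^ Suc j - of_bit (x j) / 2 ^ Suc j)"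
    by (rule suminf_finite) (auto simp: add_delta_apply simp del: plus_fun_apply)
  finally show ?thesis
    by (cases "x k") (auto simp: add_delta_apply simp del: plus_fun_apply)
qed

text \<open>The difference of the two sides of (|a| + |b|)^2 <= 2|a|^2 + 2|b|^2 is the square of |a|
  - |b|. Integrated, this takes the place of the triangle inequality in L2.\<close>

lemma norm_add_square_le: "(cmod (a + b))\<^sup>2 \<le> 2 * (cmod a)\<^sup>2 + 2 * (cmod b)\<^sup>2"
proof -
  have "(cmod (a + b))\<^sup>2 \<le> (cmod a + cmod b)\<^sup>2"
    by (intro power_mono norm_triangle_ineq) auto
  also have "\<dots> \<le> 2 * (cmod a)\<^sup>2 + 2 * (cmod b)\<^sup>2"
    using zero_le_power2[of "cmod a - cmod b"] by (simp add: power2_eq_square algebra_simps)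
  finally show ?thesis .
qed

section \<open>Measurability for Haar measure\<close>

context
  fixes \<mu> :: "seq2 measure"
  assumes haar: "haar_measure \<mu>"
begin

interpretation prob_space \<mu>
  using haar by (simp add: haar_measure_def)

lemma sets_haar: "sets \<mu> = sets (\<Pi>\<^sub>M k\<in>(UNIV :: nat set). count_space (UNIV :: bit set))"
  using haar by (simp add: haar_measure_def)

lemma space_haar: "space \<mu> = UNIV"
  using sets_eq_imp_space_eq[OF sets_haar] by (simp add: space_PiM)

lemma measurable_coordinate [measurable]: "(\<lambda>x. x k) \<in> \<mu> \<rightarrow>\<^sub>M count_space UNIV"
  by (subst measurable_cong_sets[OF sets_haar refl]) simp

lemma measurable_add_delta [measurable]: "(\<lambda>x. x + \<delta> k) \<in> \<mu> \<rightarrow>\<^sub>M \<mu>"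
proof (subst measurable_cong_sets[OF refl sets_haar], rule measurable_PiM_single')
  show "(\<lambda>x. (x + \<delta> k) i) \<in> \<mu> \<rightarrow>\<^sub>M count_space UNIV" for i
    using measurable_compose[OF measurable_coordinate, of "\<lambda>b. b + \<delta> k i" "count_space UNIV" i]
    by simp
qed (auto simp: space_haar)

lemma measurable_of_coordinate [measurable]: "(\<lambda>x. h (x k)) \<in> borel_measurable \<mu>"
  for h :: "bit \<Rightarrow> 'b::topological_space"
  by (rule measurable_compose[OF measurable_coordinate]) simp

section \<open>Walsh and Fourier functions\<close>

lemma walsh_lipschitz2:
  assumes "\<alpha> \<in> \<Delta>"
  shows "walsh \<alpha> \<in> lipschitz2 \<mu>"
proof (rule lipschitz2_finite_support[where B = 1 and I = "{k. \<alpha> k \<noteq> 0}"])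
  \<comment> \<open>The product form has one factor per coordinate, so measurability and invariance
    can be checked factor by factor.\<close>
  have eq: "walsh \<alpha> = (\<lambda>x. \<Prod>k | \<alpha> k \<noteq> 0. (-1) ^ (of_bit (\<alpha> k * x k) :: nat))"
    by (simp add: fun_eq_iff walsh_def power_sum)
  show "walsh \<alpha> \<in> borel_measurable \<mu>"
    unfolding eq by (intro borel_measurable_prod measurable_of_coordinate)
  show "cmod (walsh \<alpha> x) \<le> 1" for x
    by (simp add: walsh_def norm_power)
  show "finite {k. \<alpha> k \<noteq> 0}" using assms by (simp add: \<Delta>_def)
  show "walsh \<alpha> (x + \<delta> k) = walsh \<alpha> x" if "k \<notin> {k. \<alpha> k \<noteq> 0}" for k x
    unfolding eq
  proof (rule prod.cong)
    fix j assume "j \<in> {k. \<alpha> k \<noteq> 0}"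
    with that have "j \<noteq> k" by auto
    then have "(x + \<delta> k) j = x j" by (simp only: add_delta_apply if_False)
    then show "(-1) ^ (of_bit (\<alpha> j * (x + \<delta> k) j) :: nat) = ((-1) ^ (of_bit (\<alpha> j * x j) :: nat) :: complex)"
      by (simp only:)
  qed (rule refl)
qed

lemma fourier_lipschitz2: "fourier n \<in> lipschitz2 \<mu>"
proof (rule lipschitz2I)
  have eq: "fourier n x = exp (\<i> * of_real (2 * pi * of_int n * dyadic x))" for x
    unfolding fourier_def by (simp add: mult_ac)
  have "dyadic \<in> borel_measurable \<mu>"
    unfolding dyadic_def by measurable
  then show "fourier n \<in> borel_measurable \<mu>"
    unfolding fourier_def by measurable
  show "cmod (fourier n x) \<le> 1" for x
    unfolding eq norm_exp_i_times by simp
  \<comment> \<open>The phase has slope 2 pi |n| in the dyadic value, which moves by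
    \<open>1 / 2 ^ Suc k\<close>; hence the constant pi |n|.\<close>
  show "cmod (fourier n (x + \<delta> k) - fourier n x) \<le> (pi * \<bar>of_int n\<bar>) / 2 ^ k" for k x
  proof -
    have "cmod (fourier n (x + \<delta> k) - fourier n x)
        \<le> \<bar>2 * pi * of_int n * dyadic (x + \<delta> k) - 2 * pi * of_int n * dyadic x\<bar>"
      unfolding eq by (rule norm_exp_i_diff_le)
    also have "\<dots> = 2 * pi * \<bar>of_int n\<bar> * \<bar>dyadic (x + \<delta> k) - dyadic x\<bar>"
      by (simp add: abs_mult flip: right_diff_distrib)
    finally show ?thesis by (simp add: dyadic_add_delta)
  qed
qed

section \<open>Convergence of the two series\<close>

lemma bounded_L2:
  assumes "f \<in> borel_measurable \<mu>" "\<And>x. cmod (f x) \<le> B"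
  shows "f \<in> L2 \<mu>"
proof -
  have "integrable \<mu> (\<lambda>x. (cmod (f x))\<^sup>2)"
    using assms by (intro integrable_const_bound[where B = "B\<^sup>2"]) (auto intro!: power_mono AE_I2)
  then show ?thesis using assms by (simp add: L2_def)
qed

text \<open>Comparison with the geometric series gives pointwise convergence and one bound
  \<open>B\<close> for all partial sums and for the limit. Dominated convergence then gives
  convergence in L2, constants being integrable for a probability measure.\<close>

lemma L2_tendsto_geometric_series:
  fixes T :: "nat \<Rightarrow> seq2 \<Rightarrow> complex"
  assumes meas [measurable]: "\<And>k. T k \<in> borel_measurable \<mu>"
    and bound: "\<And>k x. cmod (T k x) \<le> C / 2 ^ k"
  shows "L2_tendsto \<mu> (\<lambda>n x. \<Sum>k<n. T k x) (\<lambda>x. \<Sum>k. T k x)"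
proof -
  have geom: "summable (\<lambda>k. C / 2 ^ k)"
    using summable_mult[OF summable_geometric[of "1 / 2 :: real"], of C] by (simp add: power_divide)
  have nneg: "0 \<le> C / 2 ^ k" for k using bound[of k 0] norm_ge_zero order_trans by blast
  define B where "B = (\<Sum>k. C / 2 ^ k)"
  have abs: "summable (\<lambda>k. cmod (T k x))" for x
    by (rule summable_comparison_test'[OF geom, of 0]) (simp add: bound)
  have summ: "summable (\<lambda>k. T k x)" for x
    using abs by (rule summable_norm_cancel)
  have part: "cmod (\<Sum>k<n. T k x) \<le> B" for n x
  proof -
    have "cmod (\<Sum>k<n. T k x) \<le> (\<Sum>k<n. C / 2 ^ k)"
      by (rule sum_norm_le) (rule bound)
    also have "\<dots> \<le> B"
      unfolding B_def by (rule sum_le_suminf[OF geom]) (auto simp: nneg)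
    finally show ?thesis .
  qed
  have lim: "cmod (\<Sum>k. T k x) \<le> B" for x
    using LIMSEQ_le_const2[OF tendsto_norm[OF summable_LIMSEQ[OF summ]]] part by blast
  have "(\<lambda>n. \<integral>x. (cmod ((\<Sum>k<n. T k x) - (\<Sum>k. T k x)))\<^sup>2 \<partial>\<mu>) \<longlonglongrightarrow> (\<integral>x. 0 \<partial>\<mu>)"
  proof (rule integral_dominated_convergence[where w = "\<lambda>_. (2 * B)\<^sup>2"])
    show "AE x in \<mu>. (\<lambda>n. (cmod ((\<Sum>k<n. T k x) - (\<Sum>k. T k x)))\<^sup>2) \<longlonglongrightarrow> 0"
    proof (rule AE_I2)
      fix x
      have "(\<lambda>n. (\<Sum>k<n. T k x) - (\<Sum>k. T k x)) \<longlonglongrightarrow> 0"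
        using LIM_zero[OF summable_LIMSEQ[OF summ]] .
      then show "(\<lambda>n. (cmod ((\<Sum>k<n. T k x) - (\<Sum>k. T k x)))\<^sup>2) \<longlonglongrightarrow> 0"
        using tendsto_power[OF tendsto_norm_zero, of _ sequentially 2] by simp
    qed
    show "AE x in \<mu>. norm ((cmod ((\<Sum>k<n. T k x) - (\<Sum>k. T k x)))\<^sup>2) \<le> (2 * B)\<^sup>2" for n
    proof (rule AE_I2)
      fix x
      have "cmod ((\<Sum>k<n. T k x) - (\<Sum>k. T k x)) \<le> 2 * B"
        using norm_triangle_ineq4[of "\<Sum>k<n. T k x" "\<Sum>k. T k x"] part[of x n] lim[of x]
        by linarith
      from power_mono[OF this norm_ge_zero, of 2]
      show "norm ((cmod ((\<Sum>k<n. T k x) - (\<Sum>k. T k x)))\<^sup>2) \<le> (2 * B)\<^sup>2"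
        by simp
    qed
  qed auto
  then have "(\<lambda>n. L2_norm \<mu> (\<lambda>x. (\<Sum>k<n. T k x) - (\<Sum>k. T k x))) \<longlonglongrightarrow> 0"
    unfolding L2_norm_def using tendsto_real_sqrt by fastforce
  moreover have "(\<lambda>x. \<Sum>k<n. T k x) \<in> L2 \<mu>" for n
    using part by (intro bounded_L2[where B = B]) auto
  moreover have "(\<lambda>x. \<Sum>k. T k x) \<in> L2 \<mu>"
    using lim by (intro bounded_L2[where B = B]) auto
  ultimately show ?thesis by (simp add: L2_tendsto_def)
qed

text \<open>Since \<open>c k\<close> is unimodular, \<open>J c k\<close> and \<open>J' c k\<close>
  merely shift absolute values by \<open>\<delta> k\<close>. Each term of either series thus
  inherits the geometric bound on the increments of \<open>f\<close>, and the factor 1/2 compensates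
  for adding two operators.\<close>

lemma lipschitz2_dom:
  assumes rep: "clifford_rep \<mu> c"
  shows "lipschitz2 \<mu> \<subseteq> dom_D \<mu> c" and "lipschitz2 \<mu> \<subseteq> dom_D' \<mu> c"
proof -
  have [measurable]: "c k \<in> borel_measurable \<mu>" and c1: "cmod (c k x) = 1" for k x
    using rep by (auto simp: clifford_rep_def)
  have "f \<in> dom_D \<mu> c \<and> f \<in> dom_D' \<mu> c" if "f \<in> lipschitz2 \<mu>" for f
  proof -
    obtain B C where [measurable]: "f \<in> borel_measurable \<mu>" and B: "\<And>x. cmod (f x) \<le> B"
      and C: "\<And>k x. cmod (f (x + \<delta> k) - f x) \<le> C / 2 ^ k"
      using \<open>f \<in> lipschitz2 \<mu>\<close> by (rule lipschitz2E) blast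
    have f: "f \<in> L2 \<mu>" using B by (intro bounded_L2) auto
    have pd_meas [measurable]: "pd k f \<in> borel_measurable \<mu>" for k
      unfolding pd_def by measurable
    have pd_bound: "cmod (pd k f x) \<le> C / 2 ^ k" for k x
      using C by (simp add: pd_def norm_mult norm_power)
    \<comment> \<open>A general index set covers both signs: the sum over \<open>j < k\<close> in
      \<open>J\<close> and the one over \<open>j \<le> k\<close> in \<open>J'\<close>.\<close>
    have [measurable]: "(\<lambda>x. (-1) ^ (\<Sum>j\<in>I. of_bit (x j) :: nat) :: complex) \<in> borel_measurable \<mu>"
      for I :: "nat set"
      unfolding power_sum by measurable
    have [measurable]: "J c k (pd k f) \<in> borel_measurable \<mu>"
      "J' c k (pd k f) \<in> borel_measurable \<mu>" for k
      unfolding J_def J'_def by measurable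
    have J: "cmod (\<i> * J c k (pd k f) x) \<le> C / 2 ^ k" "cmod (J' c k (pd k f) x) \<le> C / 2 ^ k" for k x
      using pd_bound by (simp_all add: J_def J'_def norm_mult norm_power c1)
    have "L2_tendsto \<mu> (\<lambda>n x. \<Sum>k<n. ann c k (pd k f) x) (\<lambda>x. \<Sum>k. ann c k (pd k f) x)"
    proof (rule L2_tendsto_geometric_series)
      show "ann c k (pd k f) \<in> borel_measurable \<mu>" for k
        unfolding ann_def by measurable
      show "cmod (ann c k (pd k f) x) \<le> C / 2 ^ k" for k x
        using norm_triangle_le_diff[OF add_mono[OF J(1)[of k x] J(2)[of k x]]]
        by (simp add: ann_def norm_mult mult.commute)
    qed
    moreover have "L2_tendsto \<mu> (\<lambda>n x. \<Sum>k<n. ann_adj c k (pd k f) x)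
        (\<lambda>x. \<Sum>k. ann_adj c k (pd k f) x)"
    proof (rule L2_tendsto_geometric_series)
      show "ann_adj c k (pd k f) \<in> borel_measurable \<mu>" for k
        unfolding ann_adj_def by measurable
      show "cmod (ann_adj c k (pd k f) x) \<le> C / 2 ^ k" for k x
        using norm_triangle_mono[OF J(1)[of k x] J(2)[of k x]]
        by (simp add: ann_adj_def norm_mult mult.commute)
    qed
    ultimately show ?thesis using f unfolding dom_D_def dom_D'_def by blast
  qed
  then show "lipschitz2 \<mu> \<subseteq> dom_D \<mu> c" "lipschitz2 \<mu> \<subseteq> dom_D' \<mu> c" by auto
qed

section \<open>Closure in L2\<close>

lemma lipschitz2_L2: "lipschitz2 \<mu> \<subseteq> L2 \<mu>"
  by (auto elim!: lipschitz2E intro: bounded_L2)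

lemma L2_add:
  assumes f: "f \<in> L2 \<mu>" and g: "g \<in> L2 \<mu>"
  shows "(\<lambda>x. f x + g x) \<in> L2 \<mu>"
    and "(\<integral>x. (cmod (f x + g x))\<^sup>2 \<partial>\<mu>) \<le> 2 * (\<integral>x. (cmod (f x))\<^sup>2 \<partial>\<mu>) + 2 * (\<integral>x. (cmod (g x))\<^sup>2 \<partial>\<mu>)"
proof -
  have [measurable]: "f \<in> borel_measurable \<mu>" "g \<in> borel_measurable \<mu>"
    and int: "integrable \<mu> (\<lambda>x. (cmod (f x))\<^sup>2)" "integrable \<mu> (\<lambda>x. (cmod (g x))\<^sup>2)"
    using f g by (auto simp: L2_def)
  have int2: "integrable \<mu> (\<lambda>x. 2 * (cmod (f x))\<^sup>2 + 2 * (cmod (g x))\<^sup>2)"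
    using int by simp
  have int3: "integrable \<mu> (\<lambda>x. (cmod (f x + g x))\<^sup>2)"
    by (rule Bochner_Integration.integrable_bound[OF int2]) (auto simp: norm_add_square_le)
  then show "(\<lambda>x. f x + g x) \<in> L2 \<mu>" by (simp add: L2_def)
  show "(\<integral>x. (cmod (f x + g x))\<^sup>2 \<partial>\<mu>) \<le> 2 * (\<integral>x. (cmod (f x))\<^sup>2 \<partial>\<mu>) + 2 * (\<integral>x. (cmod (g x))\<^sup>2 \<partial>\<mu>)"
    using integral_mono[OF int3 int2 norm_add_square_le]
    by (simp only: Bochner_Integration.integral_add[OF integrable_mult_right[OF int(1)] integrable_mult_right[OF int(2)]]
        integral_mult_right_zero)
qed

lemma L2_scale:
  assumes "f \<in> L2 \<mu>"
  shows "(\<lambda>x. a * f x) \<in> L2 \<mu>"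
proof -
  have f: "f \<in> borel_measurable \<mu>" "integrable \<mu> (\<lambda>x. (cmod (f x))\<^sup>2)"
    using assms by (auto simp: L2_def)
  have "(\<lambda>x. a * f x) \<in> borel_measurable \<mu>"
    by (rule borel_measurable_times[OF borel_measurable_const f(1)])
  moreover have "integrable \<mu> (\<lambda>x. (cmod (a * f x))\<^sup>2)"
    unfolding norm_mult power_mult_distrib using f(2) by (rule integrable_mult_right)
  ultimately show ?thesis unfolding L2_def by blast
qed

lemma L2_diff:
  assumes "f \<in> L2 \<mu>" "g \<in> L2 \<mu>"
  shows "(\<lambda>x. f x - g x) \<in> L2 \<mu>"
  using L2_add(1)[OF assms(1) L2_scale[OF assms(2), of "-1"]] by simp

text \<open>The L2 closure of \<open>lipschitz2 \<mu>\<close>. Squared distances are used to avoid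
  square roots; as \<epsilon> is arbitrary, the closure is the same.\<close>

definition closure_lip :: "(seq2 \<Rightarrow> complex) set"
  where "closure_lip = {g \<in> L2 \<mu>. \<forall>\<epsilon>>0. \<exists>f\<in>lipschitz2 \<mu>. (\<integral>x. (cmod (f x - g x))\<^sup>2 \<partial>\<mu>) < \<epsilon>}"

lemma closure_lip_add:
  assumes "f \<in> closure_lip" "g \<in> closure_lip"
  shows "(\<lambda>x. f x + g x) \<in> closure_lip"
proof -
  have L2: "f \<in> L2 \<mu>" "g \<in> L2 \<mu>" using assms by (auto simp: closure_lip_def)
  have "\<exists>h\<in>lipschitz2 \<mu>. (\<integral>x. (cmod (h x - (f x + g x)))\<^sup>2 \<partial>\<mu>) < \<epsilon>" if "\<epsilon> > 0" for \<epsilon> :: real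
  proof -
    \<comment> \<open>\<open>L2_add\<close> doubles each squared distance, so two errors below
      \<epsilon>/4 add up to less than \<epsilon>.\<close>
    have "\<epsilon> / 4 > 0" using that by simp
    with assms obtain f' g' where l: "f' \<in> lipschitz2 \<mu>" "g' \<in> lipschitz2 \<mu>"
      and 1: "(\<integral>x. (cmod (f' x - f x))\<^sup>2 \<partial>\<mu>) < \<epsilon> / 4" and 2: "(\<integral>x. (cmod (g' x - g x))\<^sup>2 \<partial>\<mu>) < \<epsilon> / 4"
      unfolding closure_lip_def by blast
    have "(\<integral>x. (cmod ((f' x - f x) + (g' x - g x)))\<^sup>2 \<partial>\<mu>) < \<epsilon>"
      using L2_add(2)[OF L2_diff L2_diff, of f' f g' g] subsetD[OF lipschitz2_L2] l L2 1 2 by simp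
    then have "(\<integral>x. (cmod ((f' + g') x - (f x + g x)))\<^sup>2 \<partial>\<mu>) < \<epsilon>"
      by (simp add: algebra_simps)
    moreover have "f' + g' \<in> lipschitz2 \<mu>"
      using subspace_lipschitz2 l by (rule fun_complex.subspace_add)
    ultimately show ?thesis by blast
  qed
  then show ?thesis using L2 L2_add(1) by (auto simp: closure_lip_def)
qed

lemma lipschitz2_subset_closure: "lipschitz2 \<mu> \<subseteq> closure_lip"
  using lipschitz2_L2 unfolding closure_lip_def by (auto intro!: bexI)

lemma closure_lip_scale:
  assumes "f \<in> closure_lip"
  shows "(\<lambda>x. a * f x) \<in> closure_lip"
proof -
  have L2: "f \<in> L2 \<mu>" using assms by (auto simp: closure_lip_def)
  have "\<exists>h\<in>lipschitz2 \<mu>. (\<integral>x. (cmod (h x - a * f x))\<^sup>2 \<partial>\<mu>) < \<epsilon>" if "\<epsilon> > 0" for \<epsilon> :: real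
  proof -
    \<comment> \<open>The summand 1 keeps the divisor positive when \<open>a = 0\<close>.\<close>
    have pos: "1 + (cmod a)\<^sup>2 > 0" by (simp add: add_pos_nonneg)
    then have "\<epsilon> / (1 + (cmod a)\<^sup>2) > 0" using that by simp
    with assms obtain f' where l: "f' \<in> lipschitz2 \<mu>"
      and 1: "(\<integral>x. (cmod (f' x - f x))\<^sup>2 \<partial>\<mu>) < \<epsilon> / (1 + (cmod a)\<^sup>2)"
      unfolding closure_lip_def by blast
    have "(\<integral>x. (cmod (a * f' x - a * f x))\<^sup>2 \<partial>\<mu>) = (cmod a)\<^sup>2 * (\<integral>x. (cmod (f' x - f x))\<^sup>2 \<partial>\<mu>)"
      by (simp add: norm_mult power_mult_distrib flip: right_diff_distrib)
    also have "\<dots> \<le> (1 + (cmod a)\<^sup>2) * (\<integral>x. (cmod (f' x - f x))\<^sup>2 \<partial>\<mu>)"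
      by (intro mult_right_mono) auto
    also have "\<dots> < \<epsilon>"
      using 1 pos by (simp add: pos_less_divide_eq mult.commute)
    finally show ?thesis
      by (rule bexI[OF _ fun_complex.subspace_scale[OF subspace_lipschitz2 l]])
  qed
  then show ?thesis using L2 L2_scale by (auto simp: closure_lip_def)
qed

text \<open>Dominated convergence brings some \<open>s n\<close> close to \<open>g\<close> in L2,
  and that \<open>s n\<close> is in turn close to an element of \<open>lipschitz2 \<mu>\<close>. The
  lemma is applied twice: to unions of disjoint sets and to approximation by simple
  functions.\<close>

lemma closure_lip_dominated_limit:
  assumes s: "\<And>n. s n \<in> closure_lip" and g [measurable]: "g \<in> borel_measurable \<mu>"
    and lim: "\<And>x. (\<lambda>n. s n x) \<longlonglongrightarrow> g x"
    and w: "integrable \<mu> (\<lambda>x. (w x)\<^sup>2)"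
    and le: "\<And>n x. cmod (s n x) \<le> w x"
  shows "g \<in> closure_lip"
proof -
  have sL2: "s n \<in> L2 \<mu>" for n using s by (auto simp: closure_lip_def)
  then have [measurable]: "s n \<in> borel_measurable \<mu>" for n by (auto simp: L2_def)
  have gw: "cmod (g x) \<le> w x" for x
    using LIMSEQ_le_const2[OF tendsto_norm[OF lim]] le by blast
  have "integrable \<mu> (\<lambda>x. (cmod (g x))\<^sup>2)"
    by (rule Bochner_Integration.integrable_bound[OF w]) (auto intro!: power_mono gw)
  then have gL2: "g \<in> L2 \<mu>" by (simp add: L2_def)
  have conv: "(\<lambda>n. \<integral>x. (cmod (s n x - g x))\<^sup>2 \<partial>\<mu>) \<longlonglongrightarrow> (\<integral>x. 0 \<partial>\<mu>)"
  \<comment> \<open>The limit inherits the bound \<open>w\<close>, so the difference is at most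
    \<open>2 * w x\<close> and its square at most \<open>4 * (w x)\<^sup>2\<close>.\<close>
  proof (rule integral_dominated_convergence[where w = "\<lambda>x. 4 * (w x)\<^sup>2"])
    show "AE x in \<mu>. (\<lambda>n. (cmod (s n x - g x))\<^sup>2) \<longlonglongrightarrow> 0"
    proof (rule AE_I2)
      fix x
      show "(\<lambda>n. (cmod (s n x - g x))\<^sup>2) \<longlonglongrightarrow> 0"
        using tendsto_power[OF tendsto_norm_zero[OF LIM_zero[OF lim[of x]]], where n = 2] by simp
    qed
    show "AE x in \<mu>. norm ((cmod (s n x - g x))\<^sup>2) \<le> 4 * (w x)\<^sup>2" for n
    proof (rule AE_I2)
      fix x
      have "cmod (s n x - g x) \<le> 2 * w x"
        using norm_triangle_ineq4[of "s n x" "g x"] le[of n x] gw[of x] by linarith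
      from power_mono[OF this norm_ge_zero, of 2]
      show "norm ((cmod (s n x - g x))\<^sup>2) \<le> 4 * (w x)\<^sup>2" by (simp add: power_mult_distrib)
    qed
  qed (use w in auto)
  have "\<exists>h\<in>lipschitz2 \<mu>. (\<integral>x. (cmod (h x - g x))\<^sup>2 \<partial>\<mu>) < \<epsilon>" if "\<epsilon> > 0" for \<epsilon> :: real
  proof -
    have pos: "\<epsilon> / 4 > 0" using that by simp
    have "eventually (\<lambda>n. (\<integral>x. (cmod (s n x - g x))\<^sup>2 \<partial>\<mu>) < \<epsilon> / 4) sequentially"
      by (rule order_tendstoD(2)[OF conv]) (simp add: that)
    then obtain n where 1: "(\<integral>x. (cmod (s n x - g x))\<^sup>2 \<partial>\<mu>) < \<epsilon> / 4"
      by (auto simp: eventually_sequentially)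
    obtain h where h: "h \<in> lipschitz2 \<mu>" and 2: "(\<integral>x. (cmod (h x - s n x))\<^sup>2 \<partial>\<mu>) < \<epsilon> / 4"
      using s[of n] pos unfolding closure_lip_def by blast
    have "(\<integral>x. (cmod ((h x - s n x) + (s n x - g x)))\<^sup>2 \<partial>\<mu>) < \<epsilon>"
      using L2_add(2)[OF L2_diff L2_diff, of h "s n" "s n" g] subsetD[OF lipschitz2_L2 h] sL2 gL2 1 2
      by simp
    then show ?thesis using h by auto
  qed
  then show ?thesis using gL2 by (auto simp: closure_lip_def)
qed

lemma closure_lip_sum:
  assumes "\<And>i. i \<in> I \<Longrightarrow> f i \<in> closure_lip"
  shows "(\<lambda>x. \<Sum>i\<in>I. f i x) \<in> closure_lip"
proof -
  \<comment> \<open>This covers the empty sum and also an infinite \<open>I\<close>, over which the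
    sum is 0 by convention.\<close>
  have 0: "(\<lambda>x. 0) \<in> closure_lip"
    using lipschitz2_subset_closure fun_complex.subspace_0[OF subspace_lipschitz2, of \<mu>]
    by (auto simp: zero_fun_def)
  show ?thesis using assms
  proof (induction I rule: infinite_finite_induct)
    case (insert i I)
    then show ?case using closure_lip_add[of "f i" "\<lambda>x. \<Sum>i\<in>I. f i x"] by simp
  qed (simp_all add: 0)
qed

lemma const_in_closure: "(\<lambda>x. a) \<in> closure_lip"
  by (rule subsetD[OF lipschitz2_subset_closure], rule lipschitz2I[of _ _ "cmod a" 0]) auto

section \<open>Density\<close>

text \<open>The sets whose indicator lies in the closure include the cylinders, an
  intersection-stable generator, and are closed under complements and countable disjoint unions.
  Hence they are all measurable sets.\<close>

lemma indicator_in_closure: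
  assumes "A \<in> sets \<mu>"
  shows "indicator A \<in> closure_lip"
proof -
  let ?M = "\<lambda>_::nat. count_space (UNIV :: bit set)"
  let ?G = "prod_algebra UNIV ?M"
  have sets: "sets \<mu> = sigma_sets UNIV ?G"
    unfolding sets_haar sets_PiM by simp
  have "?G \<subseteq> Pow UNIV" by simp
  moreover have "A \<in> sigma_sets UNIV ?G" using assms by (simp add: sets)
  ultimately show ?thesis
  proof (induction rule: sigma_sets_induct_disjoint[OF Int_stable_prod_algebra,
        consumes 2, case_names basic empty compl union])
    case (basic A)
    then obtain I E where I: "finite I" and AE: "A = prod_emb UNIV ?M I (Pi\<^sub>E I E)"
      by (rule prod_algebraE)
    have Ax: "x \<in> A \<longleftrightarrow> (\<forall>i\<in>I. x i \<in> E i)" for x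
      unfolding AE prod_emb_def by (auto simp: PiE_def Pi_def)
    have "A \<in> sets \<mu>" using basic by (simp add: sets)
    then have "indicator A \<in> lipschitz2 \<mu>"
    proof (intro lipschitz2_finite_support[OF _ _ I, where B = 1])
      fix k x assume "k \<notin> I"
      \<comment> \<open>Membership in the cylinder depends only on the coordinates in
        \<open>I\<close>.\<close>
      then have "x + \<delta> k \<in> A \<longleftrightarrow> x \<in> A"
        unfolding Ax by (auto simp: add_delta_apply simp del: plus_fun_apply)
      then show "indicator A (x + \<delta> k) = (indicator A x :: complex)"
        by (simp add: indicator_def)
    qed (auto simp: indicator_def)
    then show ?case using lipschitz2_subset_closure by blast
  next
    case empty
    show ?case
      using const_in_closure[of 0] by (simp add: indicator_def [abs_def])
  next
    case (compl A)
    then have "(\<lambda>x. 1 + (-1) * indicator A x) \<in> closure_lip"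
      by (intro closure_lip_add closure_lip_scale const_in_closure)
    then show ?case
      by (rule back_subst[where P = "\<lambda>f. f \<in> closure_lip"]) (auto simp: indicator_def)
  next
    case (union A)
    note disj = union(1) and r = union(2) and A = union(3)
    have [measurable]: "A i \<in> sets \<mu>" for i using r by (auto simp: sets)
    \<comment> \<open>Disjointness turns the indicator of a finite partial union into a finite sum;
      these indicators converge pointwise and are bounded by 1.\<close>
    show "indicator (\<Union> (range A)) \<in> closure_lip"
    proof (rule closure_lip_dominated_limit[where w = "\<lambda>_. 1" and s = "\<lambda>n x. indicator (\<Union>i<n. A i) x"])
      show "(\<lambda>x. indicator (\<Union>i<n. A i) x) \<in> closure_lip" for n
      proof -
        have "(\<lambda>x. \<Sum>i<n. indicator (A i) x) \<in> closure_lip"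
          by (intro closure_lip_sum A)
        then show ?thesis
          using disj by (subst indicator_UN_disjoint) (auto simp: disjoint_family_on_def)
      qed
      show "indicator (\<Union> (range A)) \<in> borel_measurable \<mu>" by measurable
      show "(\<lambda>n. indicator (\<Union>i<n. A i) x) \<longlonglongrightarrow> (indicator (\<Union> (range A)) x :: complex)" for x
        by (rule LIMSEQ_indicator_UN)
    qed (auto simp: indicator_def)
  qed
qed

text \<open>Simple functions are finite linear combinations of indicators, hence in the closure. An
  arbitrary L2 function is a dominated pointwise limit of such functions.\<close>

lemma lipschitz2_dense: "L2_dense \<mu> (lipschitz2 \<mu>)"
proof -
  have cl: "g \<in> closure_lip" if g: "g \<in> L2 \<mu>" for g
  proof -
    have gm: "g \<in> borel_measurable \<mu>" and gi: "integrable \<mu> (\<lambda>x. (cmod (g x))\<^sup>2)"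
      using g by (auto simp: L2_def)
    \<comment> \<open>With centre 0 the distance bound becomes |F i x| <= 2 |g x|, so 2|g| is a
      square-integrable dominating function.\<close>
    from borel_measurable_implies_sequence_metric[OF gm, of 0]
    obtain F where F: "\<And>i. simple_function \<mu> (F i)"
      and lim: "\<And>x. (\<lambda>i. F i x) \<longlonglongrightarrow> g x" and le: "\<And>i x. cmod (F i x) \<le> 2 * cmod (g x)"
      by (auto simp: space_haar)
    show ?thesis
    proof (rule closure_lip_dominated_limit[OF _ gm lim _ le])
      fix n
      have "(\<lambda>x. \<Sum>y\<in>F n ` space \<mu>. y * indicator (F n -` {y} \<inter> space \<mu>) x) \<in> closure_lip"
        using F by (intro closure_lip_sum closure_lip_scale indicator_in_closure simple_functionD)
      also have "(\<lambda>x. \<Sum>y\<in>F n ` space \<mu>. y * indicator (F n -` {y} \<inter> space \<mu>) x) = F n"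
        using simple_functionD(1)[OF F[of n]]
        by (auto simp: fun_eq_iff space_haar indicator_def sum.delta' if_distrib cong: if_cong)
      finally show "F n \<in> closure_lip" .
    qed (use gi in \<open>simp add: power_mult_distrib\<close>)
  qed
  have "\<exists>f\<in>lipschitz2 \<mu>. L2_norm \<mu> (\<lambda>x. f x - g x) < \<epsilon>" if "g \<in> L2 \<mu>" "\<epsilon> > 0" for g \<epsilon>
  proof -
    \<comment> \<open>The closure is phrased with squared norms, hence the tolerance
      \<open>\<epsilon>\<^sup>2\<close>.\<close>
    have "\<epsilon>\<^sup>2 > 0" using that by simp
    with cl[OF that(1)] obtain f where f: "f \<in> lipschitz2 \<mu>" "(\<integral>x. (cmod (f x - g x))\<^sup>2 \<partial>\<mu>) < \<epsilon>\<^sup>2"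
      unfolding closure_lip_def by blast
    then have "L2_norm \<mu> (\<lambda>x. f x - g x) < \<epsilon>"
      unfolding L2_norm_def using that(2) by (simp add: real_less_lsqrt)
    then show ?thesis using f by blast
  qed
  then show ?thesis using lipschitz2_L2 by (auto simp: L2_dense_def)
qed

end

section \<open>From the auxiliary space to the spans and the domains\<close>

theorem theorem5p1:
  fixes \<mu> :: "seq2 measure" and c :: "nat \<Rightarrow> seq2 \<Rightarrow> complex"
  assumes "haar_measure \<mu>"
    and "clifford_rep \<mu> c"
  shows "fun_complex.span walsh_basis \<subseteq> dom_D \<mu> c \<and>
         fun_complex.span fourier_basis \<subseteq> dom_D \<mu> c \<and>
         fun_complex.span walsh_basis \<subseteq> dom_D' \<mu> c \<and>
         fun_complex.span fourier_basis \<subseteq> dom_D' \<mu> c \<and>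
         L2_dense \<mu> (dom_D \<mu> c) \<and>
         L2_dense \<mu> (dom_D' \<mu> c)"
proof -
  have "fun_complex.span walsh_basis \<subseteq> lipschitz2 \<mu>"
    using walsh_lipschitz2[OF assms(1)]
    by (intro fun_complex.span_minimal subspace_lipschitz2) (auto simp: walsh_basis_def)
  moreover have "fun_complex.span fourier_basis \<subseteq> lipschitz2 \<mu>"
    using fourier_lipschitz2[OF assms(1)]
    by (intro fun_complex.span_minimal subspace_lipschitz2) (auto simp: fourier_basis_def)
  moreover note dom = lipschitz2_dom[OF assms]
  \<comment> \<open>Density passes from \<open>lipschitz2 \<mu>\<close> to every larger subset of
    L2, and the domains are such subsets.\<close>
  moreover have "L2_dense \<mu> (dom_D \<mu> c)" "L2_dense \<mu> (dom_D' \<mu> c)"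
    using lipschitz2_dense[OF assms(1)] dom unfolding L2_dense_def dom_D_def dom_D'_def
    by blast+
  ultimately show ?thesis by blast
qed

end
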